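(* The space $S_0$ is completely Baire.
   Context: $S_0$ is the set $\omega^{<\omega}$ of finite sequences of natural numbers with the topology for which the sets $\{q\in\omega^{<\omega} : p\preceq q\}$, $p\in\omega^{<\omega}$, form a subbasis of the closed sets, where $\preceq$ is the prefix relation. A space is a Baire space if every intersection of countably many dense open subsets is dense. A space is completely Baire if every closed subspace of it is a Baire space. *)

theory Defs
  imports "HOL-Analysis.Analysis" "HOL-Library.Sublist"
begin

(* The cones {q. prefix p q} form a subbasis of the closed sets, i.e. their complements
   form a subbasis of the open sets. These complements cover the whole type, so no
   convention about the empty intersection is involved (see topspace_S0). *)
definition S0 :: "nat list topology" where
  "S0 = topology_generated_by {- {q. prefix p q} | p. True}"

lemma topspace_S0 [simp]: "topspace S0 = UNIV"
proof -
  have "q \<in> - {r. prefix [0] r} \<or> q \<in> - {r. prefix [1] r}" for q :: "nat list"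
    by (cases q) auto
  then show ?thesis
    unfolding S0_def topology_generated_by_topspace by blast
qed

(* The intersection with topspace X only matters for the empty family, whose
   intersection is the whole space. *)
definition Baire_space :: "'a topology \<Rightarrow> bool" where
  "Baire_space X \<longleftrightarrow>
     (\<forall>\<G>. countable \<G> \<and> (\<forall>U\<in>\<G>. openin X U \<and> X closure_of U = topspace X)
        \<longrightarrow> X closure_of (topspace X \<inter> \<Inter>\<G>) = topspace X)"

definition completely_Baire_space :: "'a topology \<Rightarrow> bool" where
  "completely_Baire_space X \<longleftrightarrow> (\<forall>F. closedin X F \<longrightarrow> Baire_space (subtopology X F))"

end

theory Submission
  imports Defs
begin

text \<open>
  In a closed subspace \<open>F\<close> of \<open>S0\<close>, every \<open>\<preceq>\<close>-minimal element \<open>a\<close> of \<open>F\<close> has a neighbourhood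
  in \<open>F\<close> inside the cone above \<open>a\<close>. Open sets are closed under prefixes, so every dense
  open subset of \<open>F\<close> contains \<open>a\<close>. Hence all minimal elements lie in the intersection
  of any family of dense open subsets, and they are dense because every nonempty open subset
  of \<open>F\<close> contains a minimal element below each of its points.
\<close>

lemma openin_S0_avoiding_cones:
  assumes "finite B"
  shows "openin S0 {q. \<forall>b\<in>B. \<not> prefix b q}"
  using assms
proof (induction B)
  case empty
  show ?case
    using openin_topspace[of S0] by simp
next
  case (insert b B)
  have "openin S0 (- {q. prefix b q})"
    unfolding S0_def by (rule topology_generated_by_Basis) blast
  with insert.IH have "openin S0 (- {q. prefix b q} \<inter> {q. \<forall>b\<in>B. \<not> prefix b q})"
    by blast
  then show ?case
    by (rule back_subst[where P = "openin S0"]) auto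
qed

text \<open>Basic neighbourhoods avoid finitely many cones: an intersection of two of them avoids
  the union of the two finite sets of roots, and a subbasic set has a single root.\<close>

lemma openin_S0_nbhd_base:
  assumes "openin S0 W" "p \<in> W"
  obtains B where "finite B" "\<forall>b\<in>B. \<not> prefix b p" "{q. \<forall>b\<in>B. \<not> prefix b q} \<subseteq> W"
proof -
  have "generate_topology_on {- {q. prefix p q} | p. True} W"
    using assms(1) by (simp add: S0_def openin_topology_generated_by_iff)
  then have "\<exists>B. finite B \<and> (\<forall>b\<in>B. \<not> prefix b p) \<and> {q. \<forall>b\<in>B. \<not> prefix b q} \<subseteq> W"
    using assms(2)
  proof induction
    case Empty
    then show ?case by simp
  next
    case (Int U V)
    then obtain B C
      where "finite B" "\<forall>b\<in>B. \<not> prefix b p" "{q. \<forall>b\<in>B. \<not> prefix b q} \<subseteq> U"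
        and "finite C" "\<forall>b\<in>C. \<not> prefix b p" "{q. \<forall>b\<in>C. \<not> prefix b q} \<subseteq> V"
      by auto
    then show ?case
      by (intro exI[of _ "B \<union> C"]) auto
  next
    case (UN K)
    from \<open>p \<in> \<Union>K\<close> obtain U where U: "U \<in> K" "p \<in> U" by blast
    obtain B
      where "finite B" "\<forall>b\<in>B. \<not> prefix b p" "{q. \<forall>b\<in>B. \<not> prefix b q} \<subseteq> U"
      using UN.IH[OF U] by blast
    moreover have "U \<subseteq> \<Union>K"
      using U(1) by blast
    ultimately show ?case
      by (intro exI[of _ B]) auto
  next
    case (Basis U)
    then obtain b where "U = - {q. prefix b q}" by blast
    with Basis show ?case
      by (intro exI[of _ "{b}"]) auto
  qed
  then show thesis
    using that by blast
qed

text \<open>Any cone that contains \<open>p\<close> also contains its extension \<open>q\<close>, so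
  a basic neighbourhood of \<open>q\<close>, which only has to avoid cones, contains
  \<open>p\<close>.\<close>

lemma openin_S0_prefix_closed:
  assumes "openin S0 W" "q \<in> W" "prefix p q"
  shows "p \<in> W"
proof -
  obtain B where B: "\<forall>b\<in>B. \<not> prefix b q" "{q. \<forall>b\<in>B. \<not> prefix b q} \<subseteq> W"
    using openin_S0_nbhd_base[OF assms(1,2)] .
  have "\<forall>b\<in>B. \<not> prefix b p"
    using B(1) prefix_order.trans[OF _ assms(3)] by blast
  with B(2) show ?thesis by blast
qed

text \<open>The complement of \<open>F\<close> is open, hence prefix-closed, so
  \<open>butlast a \<notin> F\<close> already excludes every proper prefix of \<open>a\<close> from
  \<open>F\<close>.\<close>

lemma closedin_S0_minimal_isolated:
  assumes F: "closedin S0 F" and a: "a = [] \<or> butlast a \<notin> F"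
  obtains V where "openin S0 V" "a \<in> V" "\<forall>q\<in>V \<inter> F. prefix a q"
proof (cases "a = []")
  case True
  then show ?thesis
    using that[of UNIV] openin_topspace[of S0] by simp
next
  case False
  have "openin S0 (- F)"
    using F by (simp add: closedin_def Compl_eq_Diff_UNIV)
  with a False obtain B
    where B: "finite B" "\<forall>b\<in>B. \<not> prefix b (butlast a)" "{q. \<forall>b\<in>B. \<not> prefix b q} \<subseteq> - F"
    using openin_S0_nbhd_base[of "- F" "butlast a"] by auto
  \<comment> \<open>A prefix of \<open>a\<close> is \<open>a\<close> itself or a prefix of
    \<open>butlast a\<close>, and \<open>B\<close> contains none of the latter.\<close>
  have a_only: "b = a" if "b \<in> B" "prefix b a" for b
    using that B(2) False prefix_snoc[of b "butlast a" "last a"] by auto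
  show ?thesis
  proof
    show "openin S0 {q. \<forall>b\<in>B - {a}. \<not> prefix b q}"
      using B(1) by (intro openin_S0_avoiding_cones) simp
    show "a \<in> {q. \<forall>b\<in>B - {a}. \<not> prefix b q}"
      using a_only by blast
    \<comment> \<open>Every point of \<open>F\<close> lies in a cone with root in \<open>B\<close>;
      if all roots other than \<open>a\<close> are avoided, that root is \<open>a\<close>.\<close>
    show "\<forall>q\<in>{q. \<forall>b\<in>B - {a}. \<not> prefix b q} \<inter> F. prefix a q"
      using B(3) by blast
  qed
qed

lemma minimal_prefix_exists:
  assumes "q \<in> F"
  obtains a where "prefix a q" "a \<in> F" "a = [] \<or> butlast a \<notin> F"
  using assms
proof (induction q arbitrary: thesis rule: rev_induct)
  case Nil
  then show ?case by blast
next
  case (snoc x q)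
  show ?case
  proof (cases "q \<in> F")
    case True
    then show ?thesis
      using snoc.IH[of thesis] snoc.prems(1) by (auto simp: prefix_snoc)
  next
    case False
    then show ?thesis
      using snoc.prems(1)[of "q @ [x]"] snoc.prems(2) by simp
  qed
qed

theorem theorem6p3:
  shows "completely_Baire_space S0"
  unfolding completely_Baire_space_def Baire_space_def
proof (intro allI impI)
  fix F :: "nat list set" and \<G>
  let ?X = "subtopology S0 F"
  assume F: "closedin S0 F"
    and "countable \<G> \<and> (\<forall>U\<in>\<G>. openin ?X U \<and> ?X closure_of U = topspace ?X)"
  then have \<G>: "openin ?X U" "?X closure_of U = topspace ?X" if "U \<in> \<G>" for U
    using that by auto
  have minimal_in: "a \<in> U" if a: "a \<in> F" "a = [] \<or> butlast a \<notin> F" and U: "U \<in> \<G>" for a U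
  proof -
    obtain V where V: "openin S0 V" "a \<in> V" "\<forall>q\<in>V \<inter> F. prefix a q"
      using closedin_S0_minimal_isolated[OF F a(2)] .
    then have "openin ?X (V \<inter> F)" "V \<inter> F \<noteq> {}"
      using a(1) by (auto simp: openin_subtopology)
    \<comment> \<open>Density only gives some point \<open>q\<close> of \<open>U\<close> near
      \<open>a\<close>, but \<open>q\<close> extends \<open>a\<close>, so prefix-closure of
      \<open>W\<close> carries membership back down to \<open>a\<close>.\<close>
    then obtain q where q: "q \<in> U" "q \<in> V \<inter> F"
      using \<G>(2)[OF U] unfolding dense_intersects_open by blast
    obtain W where W: "openin S0 W" "U = W \<inter> F"
      using \<G>(1)[OF U] by (auto simp: openin_subtopology)
    then show ?thesis
      using q V(3) a(1) openin_S0_prefix_closed[of W q a] by blast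
  qed
  show "?X closure_of (topspace ?X \<inter> \<Inter>\<G>) = topspace ?X"
    unfolding dense_intersects_open
  proof (intro allI impI)
    fix T
    assume T: "openin ?X T \<and> T \<noteq> {}"
    then obtain W q where W: "openin S0 W" "T = W \<inter> F" and q: "q \<in> W" "q \<in> F"
      by (auto simp: openin_subtopology)
    obtain a where a: "prefix a q" "a \<in> F" "a = [] \<or> butlast a \<notin> F"
      using minimal_prefix_exists[OF q(2)] .
    \<comment> \<open>The same descent, now from an arbitrary point of \<open>T\<close> to a minimal
      element of \<open>F\<close> below it.\<close>
    then have "a \<in> T"
      using W q(1) openin_S0_prefix_closed by blast
    moreover have "a \<in> topspace ?X \<inter> \<Inter>\<G>"
      using a minimal_in by simp
    ultimately show "(topspace ?X \<inter> \<Inter>\<G>) \<inter> T \<noteq> {}"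
      by blast
  qed
qed

end
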